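(* Let $0<p<1$ and $\theta\ge 0$, and let $\mathcal{M}=\{M_n\}_{n\ge 0}$ be a logarithmically convex weight sequence with finite $p$-characteristic, $\kappa(p,\mathcal{M})<+\infty$. Then, for each $n=0,1,2,\ldots$, the map $\boldsymbol{\pi}_n$ maps $W_{\mathcal{M}}^{p,\theta}$ into $C^\infty(\mathbb{R})$, and the space $W_{\mathcal{M}}^{p,\theta}$ is coupled, in the sense that \[ \partial\,\boldsymbol{\pi}_n f=\boldsymbol{\pi}_{n+1}f,\qquad f\in W_{\mathcal{M}}^{p,\theta}, \] where $\partial$ is the differentiation operation. Moreover, the projection $\boldsymbol{\pi}_0$ is injective on $W_{\mathcal{M}}^{p,\theta}$, and, in the natural sense, the space equals the collection of test functions: $W_{\mathcal{M}}^{p,\theta}=\mathscr{S}_{p,\theta,\mathcal{M}}^\circledast$ (that is, the canonical embedding of $\mathscr{S}_{p,\theta,\mathcal{M}}^\circledast$ into its completion $W_{\mathcal{M}}^{p,\theta}$ is onto).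
   Context: $\|f\|_p=(\int_{\mathbb{R}}|f|^p\,dx)^{1/p}$ is the quasinorm of $L^p=L^p(\mathbb{R})$. A weight sequence $\mathcal{M}=\{M_n\}_{n\ge 0}$ is a sequence of positive real numbers; it is logarithmically convex if $n\mapsto\log M_n$ is convex. The $p$-characteristic is $\kappa(p,\mathcal{M})=\limsup_{n\to+\infty}\sum_{j=1}^{n}(1-p)^j\log M_j$. For $f\in C^\infty(\mathbb{R})$ put $\|f\|_{p,\mathcal{M}}=\sup_{n\ge 0}\|f^{(n)}\|_p/M_n$. The test class is \[ \mathscr{S}_{p,\theta,\mathcal{M}}^\circledast=\Big\{f\in C^\infty(\mathbb{R}):\ \|f\|_{p,\mathcal{M}}<+\infty\ \text{ and }\ \limsup_{n\to+\infty}(1-p)^n\log\|f^{(n)}\|_\infty\le\theta\Big\} \] (with $\log 0=-\infty$). The $L^p$-Carleman space $W^{p,\theta}_{\mathcal{M}}$ is the abstract completion of $\mathscr{S}_{p,\theta,\mathcal{M}}^\circledast$ with respect to $\|\cdot\|_{p,\mathcal{M}}$. Let $\ell^\infty(L^p,\mathcal{M})$ be the space of sequences $(f_0,f_1,f_2,\ldots)$ in $L^p$ with finite quasinorm $\sup_{n\ge 0}\|f_n\|_p/M_n$. The map $\boldsymbol{\pi}f=(f,f',f'',\ldots)$ on test functions extends to an isometry $\boldsymbol{\pi}:W^{p,\theta}_{\mathcal{M}}\to\ell^\infty(L^p,\mathcal{M})$; $\boldsymbol{\pi}_n f\in L^p$ denotes the $n$-th component of $\boldsymbol{\pi}f$.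 *)

theory Defs
  imports "HOL-Analysis.Analysis"
begin

definition ennreal_power :: "ennreal \<Rightarrow> real \<Rightarrow> ennreal" where
  "ennreal_power x a = (if x = \<infinity> then \<infinity> else ennreal (enn2real x powr a))"

definition Lp_norm :: "real \<Rightarrow> (real \<Rightarrow> complex) \<Rightarrow> ennreal" where
  "Lp_norm p f = ennreal_power (\<integral>\<^sup>+ x. ennreal (norm (f x) powr p) \<partial>lborel) (1 / p)"

text \<open>
  The supremum norm; it is only applied to continuous functions, for which it agrees with the
  essential supremum.
\<close>

definition sup_norm :: "(real \<Rightarrow> complex) \<Rightarrow> ennreal" where
  "sup_norm f = (SUP x. ennreal (norm (f x)))"

definition elog :: "ennreal \<Rightarrow> ereal" where
  "elog x = (if x = 0 then - \<infinity> else if x = \<infinity> then \<infinity> else ereal (ln (enn2real x)))"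

definition seq_norm :: "real \<Rightarrow> (nat \<Rightarrow> real) \<Rightarrow> (nat \<Rightarrow> real \<Rightarrow> complex) \<Rightarrow> ennreal" where
  "seq_norm p M u = (SUP n. Lp_norm p (u n) / ennreal (M n))"

text \<open>
  Convexity of \<open>n \<mapsto> log M\<^sub>n\<close> on the natural numbers, regarded as a subset of the real line.
\<close>

definition log_convex :: "(nat \<Rightarrow> real) \<Rightarrow> bool" where
  "log_convex M \<longleftrightarrow>
     (\<forall>i j k. \<forall>t\<in>{0..1}. real k = (1 - t) * real i + t * real j \<longrightarrow>
        ln (M k) \<le> (1 - t) * ln (M i) + t * ln (M j))"

definition p_characteristic :: "real \<Rightarrow> (nat \<Rightarrow> real) \<Rightarrow> ereal" where
  "p_characteristic p M = limsup (\<lambda>n. ereal (\<Sum>j=1..n. (1 - p) ^ j * ln (M j)))"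

definition vderiv :: "(real \<Rightarrow> complex) \<Rightarrow> real \<Rightarrow> complex" where
  "vderiv f x = vector_derivative f (at x)"

definition smooth :: "(real \<Rightarrow> complex) \<Rightarrow> bool" where
  "smooth f \<longleftrightarrow> (\<forall>n x. (vderiv ^^ n) f differentiable (at x))"

definition carleman_norm :: "real \<Rightarrow> (nat \<Rightarrow> real) \<Rightarrow> (real \<Rightarrow> complex) \<Rightarrow> ennreal" where
  "carleman_norm p M f = seq_norm p M (\<lambda>n. (vderiv ^^ n) f)"

definition test_class :: "real \<Rightarrow> real \<Rightarrow> (nat \<Rightarrow> real) \<Rightarrow> (real \<Rightarrow> complex) set" where
  "test_class p \<theta> M =
     {f. smooth f \<and> carleman_norm p M f < \<infinity> \<and>
         limsup (\<lambda>n. ereal ((1 - p) ^ n) * elog (sup_norm ((vderiv ^^ n) f))) \<le> ereal \<theta>}"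

definition cauchy_seqs ::
    "real \<Rightarrow> real \<Rightarrow> (nat \<Rightarrow> real) \<Rightarrow> (nat \<Rightarrow> real \<Rightarrow> complex) set" where
  "cauchy_seqs p \<theta> M =
     {f. (\<forall>k. f k \<in> test_class p \<theta> M) \<and>
         (\<forall>\<epsilon>>0. \<exists>N. \<forall>k\<ge>N. \<forall>l\<ge>N. carleman_norm p M (\<lambda>x. f k x - f l x) < ennreal \<epsilon>)}"

definition null_equiv ::
    "real \<Rightarrow> real \<Rightarrow> (nat \<Rightarrow> real) \<Rightarrow> ((nat \<Rightarrow> real \<Rightarrow> complex) \<times> (nat \<Rightarrow> real \<Rightarrow> complex)) set" where
  "null_equiv p \<theta> M =
     {(f, g). f \<in> cauchy_seqs p \<theta> M \<and> g \<in> cauchy_seqs p \<theta> M \<and>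
              (\<lambda>k. carleman_norm p M (\<lambda>x. f k x - g k x)) \<longlonglongrightarrow> 0}"

definition carleman_space ::
    "real \<Rightarrow> real \<Rightarrow> (nat \<Rightarrow> real) \<Rightarrow> (nat \<Rightarrow> real \<Rightarrow> complex) set set" where
  "carleman_space p \<theta> M = cauchy_seqs p \<theta> M // null_equiv p \<theta> M"

definition canonical_embedding ::
    "real \<Rightarrow> real \<Rightarrow> (nat \<Rightarrow> real) \<Rightarrow> (real \<Rightarrow> complex) \<Rightarrow> (nat \<Rightarrow> real \<Rightarrow> complex) set" where
  "canonical_embedding p \<theta> M f = null_equiv p \<theta> M `` {\<lambda>k. f}"

definition Lp_fun :: "real \<Rightarrow> (real \<Rightarrow> complex) set" where
  "Lp_fun p = {f \<in> borel_measurable lborel. Lp_norm p f < \<infinity>}"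

definition ae_equiv :: "real \<Rightarrow> ((real \<Rightarrow> complex) \<times> (real \<Rightarrow> complex)) set" where
  "ae_equiv p = {(f, g). f \<in> Lp_fun p \<and> g \<in> Lp_fun p \<and> (AE x in lborel. f x = g x)}"

definition Lp_space :: "real \<Rightarrow> (real \<Rightarrow> complex) set set" where
  "Lp_space p = Lp_fun p // ae_equiv p"

definition Lp_class :: "real \<Rightarrow> (real \<Rightarrow> complex) \<Rightarrow> (real \<Rightarrow> complex) set" where
  "Lp_class p f = ae_equiv p `` {f}"

definition rep :: "(real \<Rightarrow> complex) set \<Rightarrow> real \<Rightarrow> complex" where
  "rep A = (SOME f. f \<in> A)"

definition linf_Lp :: "real \<Rightarrow> (nat \<Rightarrow> real) \<Rightarrow> (nat \<Rightarrow> (real \<Rightarrow> complex) set) set" where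
  "linf_Lp p M = {F. (\<forall>n. F n \<in> Lp_space p) \<and> seq_norm p M (\<lambda>n. rep (F n)) < \<infinity>}"

text \<open>The quasinorm of a difference in \<open>\<ell>\<^sup>\<infinity>(L\<^sup>p, M)\<close>; the choice of representatives is immaterial.\<close>

definition linf_dist ::
    "real \<Rightarrow> (nat \<Rightarrow> real) \<Rightarrow> (nat \<Rightarrow> (real \<Rightarrow> complex) set) \<Rightarrow>
     (nat \<Rightarrow> (real \<Rightarrow> complex) set) \<Rightarrow> ennreal" where
  "linf_dist p M F G = seq_norm p M (\<lambda>n x. rep (F n) x - rep (G n) x)"

definition proj_test :: "real \<Rightarrow> (real \<Rightarrow> complex) \<Rightarrow> nat \<Rightarrow> (real \<Rightarrow> complex) set" where
  "proj_test p f = (\<lambda>n. Lp_class p ((vderiv ^^ n) f))"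

text \<open>
  Extension of \<open>proj_test\<close> by continuity: a class of Cauchy sequences is sent to the common limit
  in \<open>\<ell>\<^sup>\<infinity>(L\<^sup>p, M)\<close> of the images of its members. The limit exists and is unique because
  \<open>\<ell>\<^sup>\<infinity>(L\<^sup>p, M)\<close> is complete and \<open>proj_test\<close> preserves the quasinorm of differences.
\<close>

definition proj ::
    "real \<Rightarrow> (nat \<Rightarrow> real) \<Rightarrow> (nat \<Rightarrow> real \<Rightarrow> complex) set \<Rightarrow> nat \<Rightarrow> (real \<Rightarrow> complex) set" where
  "proj p M w =
     (THE F. F \<in> linf_Lp p M \<and>
             (\<forall>f\<in>w. (\<lambda>k. linf_dist p M (proj_test p (f k)) F) \<longlonglongrightarrow> 0))"

end

theory Submission
  imports Defs
begin

text \<open>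
  Write \<open>q = 1 - p\<close>. A function in \<open>L\<^sup>p\<close> takes arbitrarily small values, so integrating \<open>u'\<close> gives
  \<open>sup \<bar>u\<bar> \<le> \<parallel>u'\<parallel>\<^sub>p\<^sup>p (sup \<bar>u'\<bar>)\<^sup>q\<close>. Iterating this along \<open>f, f', f'', \<dots>\<close>, the last factor is
  controlled by \<open>\<theta>\<close> and the others by the \<open>p\<close>-characteristic, which yields bounds
  \<open>sup \<bar>f\<^sup>(\<^sup>m\<^sup>)\<bar> \<le> C\<^sub>m \<parallel>f\<parallel>\<close> on the test class, with \<open>\<parallel>f\<parallel>\<close> the Carleman norm. Since the series
  defining the characteristic converges, \<open>q\<^sup>m log C\<^sub>m\<close> tends to \<open>\<theta>\<close>, and hence these bounds in turn
  imply the condition defining the test class. Cauchy sequences therefore converge uniformly with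
  all derivatives, their limits satisfy the same bounds, and the test class is already complete.
\<close>

subsection \<open>The quasinorm of \<open>L\<^sup>p\<close>\<close>

text \<open>Taking p-th powers turns a bound on the quasinorm into one on an integral, where
  monotonicity, additivity and Fatou's lemma apply. If the integral is infinite, both sides
  fail.\<close>

lemma Lp_norm_le_iff:
  assumes "0 < p" "0 \<le> c"
  shows "Lp_norm p f \<le> ennreal c \<longleftrightarrow>
    (\<integral>\<^sup>+ x. ennreal (norm (f x) powr p) \<partial>lborel) \<le> ennreal (c powr p)"
proof (cases "(\<integral>\<^sup>+ x. ennreal (norm (f x) powr p) \<partial>lborel)")
  case (real r)
  have "r powr (1 / p) \<le> c \<longleftrightarrow> r \<le> c powr p"
  proof
    assume "r powr (1 / p) \<le> c"
    then have "(r powr (1 / p)) powr p \<le> c powr p"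
      using assms by (intro powr_mono2) auto
    then show "r \<le> c powr p"
      using assms real by (simp add: powr_powr)
  next
    assume "r \<le> c powr p"
    then have "r powr (1 / p) \<le> (c powr p) powr (1 / p)"
      using assms real by (intro powr_mono2) auto
    then show "r powr (1 / p) \<le> c"
      using assms by (simp add: powr_powr)
  qed
  with real assms show ?thesis
    by (simp add: Lp_norm_def ennreal_power_def ennreal_le_iff)
next
  case top
  then show ?thesis
    by (simp add: Lp_norm_def ennreal_power_def top_unique)
qed

lemma Lp_norm_minus_commute: "Lp_norm p (\<lambda>x. f x - g x) = Lp_norm p (\<lambda>x. g x - f x)"
  by (simp add: Lp_norm_def norm_minus_commute)

lemma Lp_norm_cong_AE:
  assumes "AE x in lborel. f x = g x"
  shows "Lp_norm p f = Lp_norm p g"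
proof -
  have "(\<integral>\<^sup>+ x. ennreal (norm (f x) powr p) \<partial>lborel) = (\<integral>\<^sup>+ x. ennreal (norm (g x) powr p) \<partial>lborel)"
    by (rule nn_integral_cong_AE) (use assms in \<open>eventually_elim, simp\<close>)
  then show ?thesis
    by (simp add: Lp_norm_def)
qed

lemma Lp_norm_eq_0_AE:
  assumes "0 < p" "f \<in> borel_measurable lborel" "Lp_norm p f = 0"
  shows "AE x in lborel. f x = 0"
proof -
  have [measurable]: "f \<in> borel_measurable borel"
    using assms(2) by simp
  have "Lp_norm p f \<le> ennreal 0"
    using assms by simp
  then have "(\<integral>\<^sup>+ x. ennreal (norm (f x) powr p) \<partial>lborel) = 0"
    using assms(1) by (subst (asm) Lp_norm_le_iff) auto
  then have "AE x in lborel. ennreal (norm (f x) powr p) = 0"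
    by (subst (asm) nn_integral_0_iff_AE) auto
  then show ?thesis
    by eventually_elim (simp add: ennreal_eq_0_iff)
qed

text \<open>Substitute for the triangle inequality, from \<open>|f - g| <= 2 max(|f|, |g|)\<close>.
  This gives a factor 2 in the constant; adding the two integrals before taking the root gives the
  factor 2^(1/p).\<close>

lemma Lp_norm_diff_le:
  assumes "0 < p" "0 \<le> c" "f \<in> borel_measurable lborel" "g \<in> borel_measurable lborel"
    and "Lp_norm p f \<le> ennreal c" "Lp_norm p g \<le> ennreal c"
  shows "Lp_norm p (\<lambda>x. f x - g x) \<le> ennreal (2 powr (1 + 1 / p) * c)"
proof -
  have [measurable]: "f \<in> borel_measurable borel" "g \<in> borel_measurable borel"
    using assms by simp_all
  have *: "norm (f x - g x) powr p \<le> 2 powr p * (norm (f x) powr p + norm (g x) powr p)" for x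
  proof -
    have "norm (f x - g x) \<le> 2 * max (norm (f x)) (norm (g x))"
      using norm_triangle_ineq4[of "f x" "g x"] by linarith
    then have "norm (f x - g x) powr p \<le> (2 * max (norm (f x)) (norm (g x))) powr p"
      using assms by (intro powr_mono2) auto
    also have "\<dots> = 2 powr p * max (norm (f x)) (norm (g x)) powr p"
      by (simp add: powr_mult)
    also have "\<dots> \<le> 2 powr p * (norm (f x) powr p + norm (g x) powr p)"
      by (intro mult_left_mono) (auto simp: max_def)
    finally show ?thesis .
  qed
  have "(\<integral>\<^sup>+ x. ennreal (norm (f x - g x) powr p) \<partial>lborel) \<le>
      (\<integral>\<^sup>+ x. ennreal (2 powr p) * (ennreal (norm (f x) powr p) + ennreal (norm (g x) powr p)) \<partial>lborel)"
    by (intro nn_integral_mono) (simp add: * ennreal_mult[symmetric] ennreal_plus[symmetric] del: ennreal_plus)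
  also have "\<dots> = ennreal (2 powr p) * ((\<integral>\<^sup>+ x. ennreal (norm (f x) powr p) \<partial>lborel)
      + (\<integral>\<^sup>+ x. ennreal (norm (g x) powr p) \<partial>lborel))"
    by (simp add: nn_integral_cmult nn_integral_add)
  also have "\<dots> \<le> ennreal (2 powr p) * (ennreal (c powr p) + ennreal (c powr p))"
    using assms by (intro mult_left_mono add_mono) (auto simp: Lp_norm_le_iff)
  also have "\<dots> = ennreal ((2 powr (1 + 1 / p) * c) powr p)"
    using assms
    by (simp add: ennreal_mult[symmetric] ennreal_plus[symmetric] powr_mult powr_powr powr_add
        distrib_right del: ennreal_plus)
  finally show ?thesis
    using assms by (subst Lp_norm_le_iff) auto
qed

text \<open>Fatou's lemma, applied to p-th powers.\<close>

lemma Lp_norm_le_of_tendsto: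
  assumes "0 < p" "0 \<le> c" "\<And>k. u k \<in> borel_measurable lborel"
    and "\<And>x. (\<lambda>k. u k x) \<longlonglongrightarrow> f x"
    and "eventually (\<lambda>k. Lp_norm p (u k) \<le> ennreal c) sequentially"
  shows "Lp_norm p f \<le> ennreal c"
proof -
  have [measurable]: "u k \<in> borel_measurable borel" for k
    using assms by simp
  have "(\<lambda>k. ennreal (norm (u k x) powr p)) \<longlonglongrightarrow> ennreal (norm (f x) powr p)" for x
    using assms(1) by (intro tendsto_ennrealI tendsto_powr' tendsto_norm tendsto_const assms(4)) auto
  then have "(\<integral>\<^sup>+ x. ennreal (norm (f x) powr p) \<partial>lborel) =
      (\<integral>\<^sup>+ x. liminf (\<lambda>k. ennreal (norm (u k x) powr p)) \<partial>lborel)"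
    by (intro nn_integral_cong) (metis lim_imp_Liminf sequentially_bot)
  also have "\<dots> \<le> liminf (\<lambda>k. \<integral>\<^sup>+ x. ennreal (norm (u k x) powr p) \<partial>lborel)"
    by (intro nn_integral_liminf) measurable
  also have "\<dots> \<le> ennreal (c powr p)"
    by (rule Liminf_le) (use assms in \<open>auto elim!: eventually_mono simp: Lp_norm_le_iff\<close>)
  finally show ?thesis
    using assms by (simp add: Lp_norm_le_iff)
qed

text \<open>The real line has infinite measure, so a positive lower bound on the modulus would make
  the integral diverge.\<close>

lemma Lp_norm_finite_imp_small_value:
  assumes "0 < p" "Lp_norm p f < \<infinity>" "0 < e"
  shows "\<exists>y. norm (f y) < e"
proof (rule ccontr)
  assume "\<not> ?thesis"
  then have "e powr p \<le> norm (f y) powr p" for y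
    using assms by (intro powr_mono2) (auto simp: not_less)
  then have "(\<integral>\<^sup>+ x. ennreal (e powr p) \<partial>(lborel :: real measure)) \<le> (\<integral>\<^sup>+ x. ennreal (norm (f x) powr p) \<partial>lborel)"
    by (intro nn_integral_mono) auto
  moreover have "(\<integral>\<^sup>+ x. ennreal (e powr p) \<partial>(lborel :: real measure)) = \<infinity>"
    using assms by (simp add: ennreal_mult_eq_top_iff ennreal_eq_0_iff)
  ultimately show False
    using assms(2) by (simp add: Lp_norm_def ennreal_power_def top_unique)
qed

lemma seq_norm_le_iff:
  assumes "\<And>n. 0 < M n" "0 \<le> c"
  shows "seq_norm p M u \<le> ennreal c \<longleftrightarrow> (\<forall>n. Lp_norm p (u n) \<le> ennreal (c * M n))"
proof -
  have "Lp_norm p (u n) / ennreal (M n) \<le> ennreal c \<longleftrightarrow> Lp_norm p (u n) \<le> ennreal (c * M n)" for n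
  proof (cases "Lp_norm p (u n)")
    case (real r)
    then show ?thesis
      using assms(1)[of n] assms(2) by (simp add: divide_ennreal divide_le_eq)
  next
    case top
    then show ?thesis
      by (simp add: ennreal_top_divide top_unique)
  qed
  then show ?thesis
    by (simp add: seq_norm_def SUP_le_iff)
qed

subsection \<open>Smooth functions\<close>

lemma smooth_has_vector_derivative:
  assumes "smooth f"
  shows "((vderiv ^^ n) f has_vector_derivative (vderiv ^^ Suc n) f x) (at x)"
  using assms by (simp add: smooth_def vderiv_def vector_derivative_works)

lemma smooth_iterate: "smooth f \<Longrightarrow> smooth ((vderiv ^^ n) f)"
  unfolding smooth_def by (metis funpow_add comp_apply)

lemma smooth_continuous: "smooth f \<Longrightarrow> continuous_on A ((vderiv ^^ n) f)"
  using smooth_has_vector_derivative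
  by (meson continuous_at_imp_continuous_on has_vector_derivative_continuous)

lemma smooth_measurable: "smooth f \<Longrightarrow> (vderiv ^^ n) f \<in> borel_measurable lborel"
  using borel_measurable_continuous_onI smooth_continuous by auto

text \<open>Differences and limits of smooth functions come with an explicit tower \<open>G\<close>
  of successive derivatives; this and \<open>smoothI\<close> read off the iterates of
  \<open>vderiv\<close> from such a tower.\<close>

lemma vderiv_iterate_eqI:
  assumes "\<And>n x. (G n has_vector_derivative G (Suc n) x) (at x)"
  shows "(vderiv ^^ n) (G 0) = G n"
proof (induction n)
  case (Suc n)
  moreover have "vderiv (G n) = G (Suc n)"
    using assms by (simp add: vderiv_def fun_eq_iff vector_derivative_at)
  ultimately show ?case
    by simp
qed auto

lemma smoothI:
  assumes "\<And>n x. (G n has_vector_derivative G (Suc n) x) (at x)"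
  shows "smooth (G 0)"
  unfolding smooth_def vderiv_iterate_eqI[of G, OF assms]
  using assms differentiableI_vector by blast

lemma
  assumes "smooth f" "smooth g"
  shows smooth_diff: "smooth (\<lambda>x. f x - g x)"
    and vderiv_iterate_diff:
      "(vderiv ^^ n) (\<lambda>x. f x - g x) = (\<lambda>x. (vderiv ^^ n) f x - (vderiv ^^ n) g x)"
proof -
  let ?G = "\<lambda>n x. (vderiv ^^ n) f x - (vderiv ^^ n) g x"
  have *: "(?G n has_vector_derivative ?G (Suc n) x) (at x)" for n x
    by (intro has_vector_derivative_diff smooth_has_vector_derivative assms)
  show "smooth (\<lambda>x. f x - g x)"
    using smoothI[of ?G, OF *] by simp
  show "(vderiv ^^ n) (\<lambda>x. f x - g x) = ?G n"
    using vderiv_iterate_eqI[of ?G, OF *] by simp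
qed

lemma has_vector_derivative_uniform_limit:
  fixes f :: "nat \<Rightarrow> real \<Rightarrow> 'a::banach"
  assumes der: "\<And>k x. (f k has_vector_derivative f' k x) (at x)"
    and lim: "\<And>x. (\<lambda>k. f k x) \<longlonglongrightarrow> g x"
    and unif: "\<And>e. 0 < e \<Longrightarrow> \<forall>\<^sub>F k in sequentially. \<forall>x. norm (f' k x - g' x) \<le> e"
  shows "(g has_vector_derivative g' x) (at x)"
proof -
  have "\<forall>\<^sub>F k in sequentially. \<forall>x\<in>UNIV. \<forall>t. norm (t *\<^sub>R f' k x - t *\<^sub>R g' x) \<le> e * norm t"
    if "0 < e" for e
    using unif[OF that]
    by eventually_elim
      (auto simp flip: scaleR_diff_right simp: mult.commute[of e] intro!: mult_left_mono)
  from has_derivative_sequence[where S = UNIV and f = f and f' = "\<lambda>k x t. t *\<^sub>R f' k x" and ?x0.0 = 0,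
      OF convex_UNIV _ this UNIV_I lim]
  have "\<exists>h. \<forall>x\<in>UNIV. (\<lambda>k. f k x) \<longlonglongrightarrow> h x \<and> (h has_derivative (\<lambda>t. t *\<^sub>R g' x)) (at x within UNIV)"
    using der by (simp add: has_vector_derivative_def)
  then obtain h where h: "\<And>x. (\<lambda>k. f k x) \<longlonglongrightarrow> h x"
    and h': "\<And>x. (h has_derivative (\<lambda>t. t *\<^sub>R g' x)) (at x)"
    by auto
  \<comment> \<open>\<open>has_derivative_sequence\<close> only yields some pointwise limit
    \<open>h\<close>; uniqueness of limits identifies it with the given \<open>g\<close>.\<close>
  have "h = g"
    using LIMSEQ_unique[OF h lim] by (auto simp: fun_eq_iff)
  then show ?thesis
    using h' by (simp add: has_vector_derivative_def)
qed

text \<open>The set where two continuous functions differ is open, and a nonempty open set is not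
  null.\<close>

lemma continuous_AE_eq_imp_eq:
  fixes f g :: "real \<Rightarrow> complex"
  assumes "continuous_on UNIV f" "continuous_on UNIV g" "AE x in lborel. f x = g x"
  shows "f = g"
proof -
  have "open {x. f x \<noteq> g x}"
    using assms by (intro open_Collect_neq) auto
  moreover have "{x. f x \<noteq> g x} \<in> null_sets lborel"
    using assms(3) \<open>open _\<close> by (subst AE_iff_null_sets) auto
  then have "negligible {x. f x \<noteq> g x}"
    by (simp add: negligible_iff_null_sets null_sets_completionI)
  ultimately show ?thesis
    using open_not_negligible by blast
qed

text \<open>
  Since \<open>0 < p < 1\<close>, the integral of \<open>\<bar>u'\<bar>\<close> is at most the integral of \<open>\<bar>u'\<bar>\<^sup>p\<close> times
  the supremum of \<open>\<bar>u'\<bar>\<^sup>1\<^sup>-\<^sup>p\<close>, while \<open>u\<close> is arbitrarily small at some points because it lies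
  in \<open>L\<^sup>p\<close>.
\<close>

lemma sup_bound_by_derivative:
  fixes u :: "real \<Rightarrow> complex"
  assumes p: "0 < p" "p < 1"
    and der: "\<And>x. (u has_vector_derivative u' x) (at x)"
    and cont: "continuous_on UNIV u'"
    and fin: "Lp_norm p u < \<infinity>"
    and A: "0 \<le> A" "Lp_norm p u' \<le> ennreal A"
    and B: "\<And>x. norm (u' x) \<le> B"
  shows "norm (u x) \<le> A powr p * B powr (1 - p)"
proof -
  have [measurable]: "u' \<in> borel_measurable borel"
    using cont by (rule borel_measurable_continuous_onI)
  have le: "norm (u' t) \<le> norm (u' t) powr p * B powr (1 - p)" for t
  proof (cases "u' t = 0")
    case False
    then have "norm (u' t) = norm (u' t) powr p * norm (u' t) powr (1 - p)"
      by (simp flip: powr_add)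
    also have "\<dots> \<le> norm (u' t) powr p * B powr (1 - p)"
      using p B by (intro mult_left_mono powr_mono2) auto
    finally show ?thesis .
  qed auto
  have *: "norm (u b - u a) \<le> A powr p * B powr (1 - p)" if "a \<le> b" for a b
  proof -
    have int: "integrable lborel (\<lambda>t. indicator {a..b} t *\<^sub>R u' t)"
      using borel_integrable_atLeastAtMost'[of a b u'] cont continuous_on_subset
      by (auto simp: set_integrable_def)
    have "(LBINT t. indicator {a..b} t *\<^sub>R u' t) = u b - u a"
      using that der cont
      by (intro integral_FTC_atLeastAtMost)
        (auto intro: has_vector_derivative_at_within continuous_on_subset)
    then have "ennreal (norm (u b - u a)) \<le> (\<integral>\<^sup>+ t. norm (indicator {a..b} t *\<^sub>R u' t) \<partial>lborel)"
      using integral_norm_bound_ennreal[OF int] by simp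
    also have "\<dots> \<le> (\<integral>\<^sup>+ t. ennreal (norm (u' t) powr p) * ennreal (B powr (1 - p)) \<partial>lborel)"
      using le by (intro nn_integral_mono) (auto simp: indicator_def simp flip: ennreal_mult)
    also have "\<dots> = (\<integral>\<^sup>+ t. ennreal (norm (u' t) powr p) \<partial>lborel) * ennreal (B powr (1 - p))"
      by (intro nn_integral_multc) measurable
    also have "\<dots> \<le> ennreal (A powr p) * ennreal (B powr (1 - p))"
      using A p by (intro mult_right_mono) (auto simp: Lp_norm_le_iff)
    finally show ?thesis
      by (simp flip: ennreal_mult)
  qed
  \<comment> \<open>The point \<open>y\<close> moves with \<open>e\<close>, but the bound on
    \<open>norm (u x - u y)\<close> does not depend on it.\<close>
  show ?thesis
  proof (rule field_le_epsilon)
    fix e :: real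
    assume "0 < e"
    then obtain y where "norm (u y) < e"
      using Lp_norm_finite_imp_small_value[OF p(1) fin] by blast
    moreover have "norm (u x - u y) \<le> A powr p * B powr (1 - p)"
      using *[of x y] *[of y x] by (cases "x \<le> y") (auto simp: norm_minus_commute)
    ultimately show "norm (u x) \<le> A powr p * B powr (1 - p) + e"
      using norm_triangle_ineq2[of "u x" "u y"] by linarith
  qed
qed

subsection \<open>Carleman norms\<close>

lemma carleman_norm_le_iff:
  assumes "\<And>n. 0 < M n" "0 \<le> c"
  shows "carleman_norm p M f \<le> ennreal c \<longleftrightarrow> (\<forall>n. Lp_norm p ((vderiv ^^ n) f) \<le> ennreal (c * M n))"
  using seq_norm_le_iff[of M c p] assms by (simp add: carleman_norm_def)

lemma carleman_norm_finiteE: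
  assumes "carleman_norm p M f < \<infinity>"
  obtains K where "0 < K" "carleman_norm p M f \<le> ennreal K"
proof (cases "carleman_norm p M f")
  case (real r)
  then show ?thesis
    by (intro that[of "r + 1"]) (auto intro: ennreal_leI)
qed (use assms in auto)

lemma carleman_norm_minus_commute:
  assumes "smooth f" "smooth g"
  shows "carleman_norm p M (\<lambda>x. f x - g x) = carleman_norm p M (\<lambda>x. g x - f x)"
  using assms Lp_norm_minus_commute[of p "(vderiv ^^ n) f" "(vderiv ^^ n) g" for n]
  by (simp add: carleman_norm_def seq_norm_def vderiv_iterate_diff)

lemma carleman_norm_diff_le:
  assumes "0 < p" "\<And>n. 0 < M n" "0 \<le> c" "smooth f" "smooth g"
    and "carleman_norm p M f \<le> ennreal c" "carleman_norm p M g \<le> ennreal c"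
  shows "carleman_norm p M (\<lambda>x. f x - g x) \<le> ennreal (2 powr (1 + 1 / p) * c)"
proof -
  have "Lp_norm p (\<lambda>x. (vderiv ^^ n) f x - (vderiv ^^ n) g x)
      \<le> ennreal (2 powr (1 + 1 / p) * (c * M n))" for n
    using assms less_imp_le[OF assms(2)[of n]]
    by (intro Lp_norm_diff_le smooth_measurable) (auto simp: carleman_norm_le_iff)
  then show ?thesis
    using assms by (simp add: carleman_norm_le_iff vderiv_iterate_diff mult.assoc)
qed

lemma sup_norm_le_iff: "0 \<le> c \<Longrightarrow> sup_norm f \<le> ennreal c \<longleftrightarrow> (\<forall>x. norm (f x) \<le> c)"
  by (simp add: sup_norm_def SUP_le_iff ennreal_le_iff)

text \<open>Translates the growth condition of the test class into bounds on suprema. For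
  \<open>x = 0\<close> both sides hold, for \<open>x = \<infinity>\<close> both fail.\<close>

lemma mult_elog_le_iff:
  assumes "0 < c"
  shows "ereal c * elog x \<le> ereal b \<longleftrightarrow> x \<le> ennreal (exp (b / c))"
proof (cases x)
  case (real r)
  show ?thesis
  proof (cases "r = 0")
    case False
    then have "c * ln r \<le> b \<longleftrightarrow> r \<le> exp (b / c)"
      using real assms ln_le_cancel_iff[of r "exp (b / c)"] by (simp add: field_simps)
    then show ?thesis
      using False real by (simp add: elog_def ennreal_eq_0_iff ennreal_le_iff)
  qed (use real assms in \<open>simp add: elog_def\<close>)
next
  case top
  then show ?thesis
    using assms by (simp add: elog_def top_unique)
qed

section \<open>Convergence of the series behind the characteristic\<close>

locale carleman_weight =
  fixes p \<theta> :: real and M :: "nat \<Rightarrow> real"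
  assumes p_pos: "0 < p" and p_less: "p < 1"
    and M_pos: "\<And>n. 0 < M n"
    and M_convex: "log_convex M"
    and M_char: "p_characteristic p M < \<infinity>"
begin

text \<open>
  Convexity bounds \<open>log M\<^sub>j\<close> from below by an affine function of \<open>j\<close>, whose weighted series
  converges. After subtracting it, the partial sums of the characteristic are increasing, so
  that a finite upper limit already forces convergence.
\<close>

lemma summable_weights: "summable (\<lambda>j. (1 - p) ^ j * ln (M (Suc j)))"
proof -
  define a where "a j = ln (M (Suc j))" for j
  define e where "e j = (1 - p) ^ j * (a 0 + real j * (a 1 - a 0))" for j
  define c where "c j = (1 - p) ^ j * a j - e j" for j
  have affine: "a 0 + real j * (a 1 - a 0) \<le> a j" for j
  proof (cases "j = 0")
    case False
    \<comment> \<open>Convexity at 2, written as a combination of 1 and \<open>Suc j\<close> with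
      weight \<open>1 / real j\<close> on the latter. Solved for \<open>ln (M (Suc j))\<close>, it
      bounds \<open>a j\<close> below by the line through the first two values of
      \<open>a\<close>.\<close>
    have "ln (M 2) \<le> (1 - 1 / real j) * ln (M 1) + 1 / real j * ln (M (Suc j))"
    proof -
      have "real 2 = (1 - 1 / real j) * real 1 + 1 / real j * real (Suc j)"
        using False by (simp add: field_simps)
      moreover have "1 / real j \<in> {0..1}"
        using False by simp
      ultimately show ?thesis
        using M_convex unfolding log_convex_def by blast
    qed
    then show ?thesis
      using False by (simp add: a_def field_simps numeral_2_eq_2)
  qed auto
  have c_nonneg: "0 \<le> c j" for j
    using mult_left_mono[OF affine[of j], of "(1 - p) ^ j"] p_less by (simp add: c_def e_def)
  \<comment> \<open>\<open>e\<close> is a combination of the geometric series with ratio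
    \<open>1 - p\<close> and its derivative.\<close>
  have "summable (\<lambda>j. real (Suc j) * (1 - p) ^ j)"
    using geometric_deriv_sums[of "1 - p"] p_pos p_less by (auto simp: sums_iff)
  then have "summable (\<lambda>j. (a 1 - a 0) * (real (Suc j) * (1 - p) ^ j) + (2 * a 0 - a 1) * (1 - p) ^ j)"
    using p_pos p_less by (intro summable_add summable_mult) (auto intro: summable_geometric)
  also have "(\<lambda>j. (a 1 - a 0) * (real (Suc j) * (1 - p) ^ j) + (2 * a 0 - a 1) * (1 - p) ^ j) = e"
    by (simp add: e_def fun_eq_iff algebra_simps)
  finally have "summable e" .
  then obtain D where D: "\<And>n. \<bar>\<Sum>j<n. e j\<bar> \<le> D"
    using convergent_imp_Bseq[of "\<lambda>n. \<Sum>j<n. e j"]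
    by (auto simp: summable_iff_convergent Bseq_def)
  obtain C where "p_characteristic p M < ereal C"
    using M_char by (meson ereal_dense2)
  then have "\<forall>\<^sub>F n in sequentially. ereal (\<Sum>j=1..n. (1 - p) ^ j * ln (M j)) < ereal C"
    unfolding p_characteristic_def by (rule Limsup_lessD)
  then obtain N where N: "\<And>n. N \<le> n \<Longrightarrow> (\<Sum>j=1..n. (1 - p) ^ j * ln (M j)) < C"
    by (auto simp: eventually_sequentially)
  \<comment> \<open>The sums of the characteristic are controlled only from \<open>N\<close> on; as
    the terms \<open>c\<close> are nonnegative, earlier sums are dominated by the one up to
    \<open>max n N\<close>. The division by \<open>1 - p\<close> comes from shifting the index by
    one.\<close>
  have bound: "(\<Sum>j<n. c j) \<le> C / (1 - p) + D" for n
  proof -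
    have "(\<Sum>j=1..max n N. (1 - p) ^ j * ln (M j)) = (1 - p) * (\<Sum>j<max n N. (1 - p) ^ j * a j)"
      by (simp add: sum.atLeast1_atMost_eq a_def sum_distrib_left algebra_simps)
    then have "(\<Sum>j<max n N. (1 - p) ^ j * a j) < C / (1 - p)"
      using N[of "max n N"] p_less by (simp add: field_simps)
    then have "(\<Sum>j<max n N. c j) \<le> C / (1 - p) + D"
      using D[of "max n N"] by (simp add: c_def sum_subtractf)
    moreover have "(\<Sum>j<n. c j) \<le> (\<Sum>j<max n N. c j)"
      using c_nonneg by (intro sum_mono2) auto
    ultimately show ?thesis
      by linarith
  qed
  have "summable c"
    using summableI_nonneg_bounded[of c, OF c_nonneg bound] .
  from summable_add[OF this \<open>summable e\<close>] show ?thesis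
    by (simp add: c_def a_def)
qed

section \<open>Uniform bounds for all derivatives of a test function\<close>

definition partial_weight :: "nat \<Rightarrow> real" where
  "partial_weight m = p * (\<Sum>j<m. (1 - p) ^ j * ln (M (Suc j)))"

text \<open>This is p / (1 - p) times the characteristic, whose sums start with the weight
  \<open>(1 - p) ^ 1\<close>.\<close>

definition total_weight :: real where
  "total_weight = p * (\<Sum>j. (1 - p) ^ j * ln (M (Suc j)))"

text \<open>The bound that results, for Carleman norm at most one, from iterating the derivative
  estimate from \<open>m\<close> to infinity: \<open>\<theta>\<close> comes from the far end of the
  chain, the tail of the weights from the steps in between.\<close>

definition sup_factor :: "nat \<Rightarrow> real" where
  "sup_factor m = exp ((\<theta> + total_weight - partial_weight m) / (1 - p) ^ m)"

lemma partial_weight_tendsto: "partial_weight \<longlonglongrightarrow> total_weight"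
  unfolding partial_weight_def total_weight_def
  by (intro tendsto_mult_left summable_LIMSEQ summable_weights)

lemma q_power_tendsto_0: "(\<lambda>n. (1 - p) ^ n * c) \<longlonglongrightarrow> 0"
  using p_pos p_less by (intro tendsto_mult_left_zero LIMSEQ_power_zero) auto

text \<open>With s_n the supremum of the n-th derivative's modulus,
  \<open>sup_bound_by_derivative\<close> reads s_n <= (K M_(n+1))^p s_(n+1)^(1-p). Hence (1-p)^n
  log(s_n / K) + \<open>partial_weight n\<close> is nondecreasing in n. The last hypothesis bounds
  this quantity by \<open>b\<close> at \<open>n\<close>, so the same bound holds at
  \<open>m\<close>.\<close>

lemma sup_bound_descend:
  assumes "smooth f" "0 < K" "\<And>n. Lp_norm p ((vderiv ^^ n) f) \<le> ennreal (K * M n)"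
    and le: "m \<le> n"
    and "\<And>x. norm ((vderiv ^^ n) f x) \<le> K * exp ((b - partial_weight n) / (1 - p) ^ n)"
  shows "norm ((vderiv ^^ m) f x) \<le> K * exp ((b - partial_weight m) / (1 - p) ^ m)"
  using le assms(5)
proof (induction n arbitrary: x rule: dec_induct)
  case (step n)
  let ?B = "K * exp ((b - partial_weight (Suc n)) / (1 - p) ^ Suc n)"
  have "norm ((vderiv ^^ n) f x) \<le> (K * M (Suc n)) powr p * ?B powr (1 - p)" for x
  proof (rule sup_bound_by_derivative[OF p_pos p_less smooth_has_vector_derivative[OF assms(1)]])
    show "continuous_on UNIV ((vderiv ^^ Suc n) f)"
      using assms(1) by (rule smooth_continuous)
    show "Lp_norm p ((vderiv ^^ n) f) < \<infinity>"
      using assms(3)[of n] by (simp add: order_le_less_trans)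
    show "Lp_norm p ((vderiv ^^ Suc n) f) \<le> ennreal (K * M (Suc n))"
      by (rule assms(3))
    show "0 \<le> K * M (Suc n)"
      using assms(2) M_pos[of "Suc n"] by simp
  qed (rule step.prems)
  also have "(K * M (Suc n)) powr p * ?B powr (1 - p) =
      (K powr p * K powr (1 - p)) * (exp (p * ln (M (Suc n))) *
        exp ((1 - p) * ((b - partial_weight (Suc n)) / (1 - p) ^ Suc n)))"
    using assms(2) M_pos[of "Suc n"] by (simp add: powr_mult exp_powr_real powr_def[of "M (Suc n)"] mult.commute)
  \<comment> \<open>The exponents add up to 1, so the bound stays linear in \<open>K\<close> however
    often the estimate is iterated.\<close>
  also have "K powr p * K powr (1 - p) = K"
    using assms(2) by (simp flip: powr_add)
  also have "exp (p * ln (M (Suc n))) * exp ((1 - p) * ((b - partial_weight (Suc n)) / (1 - p) ^ Suc n))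
      = exp ((b - partial_weight n) / (1 - p) ^ n)"
    using p_less by (simp add: partial_weight_def field_simps flip: exp_add)
  finally show ?case
    by (rule step.IH)
qed auto

text \<open>For large \<open>n\<close> the growth condition bounds the monotone quantity of
  \<open>sup_bound_descend\<close> by \<open>\<theta> + total_weight + e\<close>. The bound descends
  to \<open>m\<close>, and then \<open>e\<close> tends to 0.\<close>

lemma test_class_sup_bound:
  assumes f: "f \<in> test_class p \<theta> M" and K: "0 < K" "carleman_norm p M f \<le> ennreal K"
  shows "norm ((vderiv ^^ m) f x) \<le> K * sup_factor m"
proof -
  have sm: "smooth f"
    using f by (simp add: test_class_def)
  have Lp: "Lp_norm p ((vderiv ^^ n) f) \<le> ennreal (K * M n)" for n
    using K M_pos by (simp add: carleman_norm_le_iff)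
  have approx: "norm ((vderiv ^^ m) f x)
      \<le> K * exp ((\<theta> + total_weight + e - partial_weight m) / (1 - p) ^ m)" if "0 < e" for e
  proof -
    \<comment> \<open>One third of \<open>e\<close> each is spent on the upper limit, on the
      convergence of \<open>partial_weight\<close>, and on \<open>(1 - p) ^ n * ln K\<close>, which
      appears because suprema are measured relative to \<open>K\<close>.\<close>
    have "limsup (\<lambda>n. ereal ((1 - p) ^ n) * elog (sup_norm ((vderiv ^^ n) f))) < ereal (\<theta> + e / 3)"
      using f that by (auto simp: test_class_def intro: order_le_less_trans)
    then have "\<forall>\<^sub>F n in sequentially.
        ereal ((1 - p) ^ n) * elog (sup_norm ((vderiv ^^ n) f)) < ereal (\<theta> + e / 3)"
      by (rule Limsup_lessD)
    moreover have "\<forall>\<^sub>F n in sequentially. partial_weight n < total_weight + e / 3"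
      using partial_weight_tendsto that by (intro order_tendstoD(2)) auto
    moreover have "\<forall>\<^sub>F n in sequentially. - (e / 3) < (1 - p) ^ n * ln K"
      using q_power_tendsto_0 that by (intro order_tendstoD(1)) auto
    ultimately have "\<forall>\<^sub>F n in sequentially. m \<le> n \<and> (\<forall>x. norm ((vderiv ^^ n) f x)
        \<le> K * exp ((\<theta> + total_weight + e - partial_weight n) / (1 - p) ^ n))"
      using eventually_ge_at_top[of m]
    proof eventually_elim
      case (elim n)
      have q: "0 < (1 - p) ^ n"
        using p_less by simp
      have "sup_norm ((vderiv ^^ n) f) \<le> ennreal (exp ((\<theta> + e / 3) / (1 - p) ^ n))"
        using less_imp_le[OF elim(1)] q by (simp add: mult_elog_le_iff)
      then have "norm ((vderiv ^^ n) f x) \<le> exp ((\<theta> + e / 3) / (1 - p) ^ n)" for x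
        by (simp add: sup_norm_le_iff)
      moreover have "(\<theta> + e / 3) / (1 - p) ^ n
          \<le> ln K + (\<theta> + total_weight + e - partial_weight n) / (1 - p) ^ n"
      proof -
        have "(\<theta> + e / 3) / (1 - p) ^ n
            \<le> ((1 - p) ^ n * ln K + (\<theta> + total_weight + e - partial_weight n)) / (1 - p) ^ n"
          using q elim(2,3) by (intro divide_right_mono) auto
        then show ?thesis
          using p_less by (simp add: add_divide_distrib[of "(1 - p) ^ n * ln K"])
      qed
      then have "exp ((\<theta> + e / 3) / (1 - p) ^ n)
          \<le> exp (ln K + (\<theta> + total_weight + e - partial_weight n) / (1 - p) ^ n)"
        by simp
      ultimately show ?case
        using K(1) elim(4) by (auto simp: exp_add intro: order_trans)
    qed
    then obtain n where "m \<le> n" "\<And>x. norm ((vderiv ^^ n) f x)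
        \<le> K * exp ((\<theta> + total_weight + e - partial_weight n) / (1 - p) ^ n)"
      by (auto simp: eventually_sequentially)
    then show ?thesis
      by (rule sup_bound_descend[OF sm K(1) Lp])
  qed
  have "((\<lambda>e. K * exp ((\<theta> + total_weight + e - partial_weight m) / (1 - p) ^ m))
      \<longlongrightarrow> K * exp ((\<theta> + total_weight + 0 - partial_weight m) / (1 - p) ^ m)) (at_right 0)"
    using p_less by (intro tendsto_intros) auto
  then have "norm ((vderiv ^^ m) f x)
      \<le> K * exp ((\<theta> + total_weight + 0 - partial_weight m) / (1 - p) ^ m)"
    by (rule tendsto_lowerbound) (auto intro: approx eventually_mono[OF eventually_at_right_less])
  then show ?thesis
    by (simp add: sup_factor_def)
qed

text \<open>Converse of \<open>test_class_sup_bound\<close>: (1-p)^n times the logarithm of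
  \<open>K * sup_factor n\<close> is \<open>?b n\<close>, where the contribution of \<open>K\<close>
  vanishes in the limit and the weights cancel, leaving \<open>\<theta>\<close>. The upper limit is
  thus traded for pointwise bounds, which are stable under differences and limits.\<close>

lemma test_classI:
  assumes "smooth f" and K: "0 < K" "carleman_norm p M f \<le> ennreal K"
    and bound: "\<And>m x. norm ((vderiv ^^ m) f x) \<le> K * sup_factor m"
  shows "f \<in> test_class p \<theta> M"
proof -
  let ?b = "\<lambda>n. (1 - p) ^ n * ln K + (\<theta> + total_weight - partial_weight n)"
  have "ereal ((1 - p) ^ n) * elog (sup_norm ((vderiv ^^ n) f)) \<le> ereal (?b n)" for n
  proof -
    have "exp (?b n / (1 - p) ^ n) = K * sup_factor n"
      using K(1) p_less by (simp add: sup_factor_def add_divide_distrib exp_add)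
    then show ?thesis
      using bound[of n] K(1) p_less
      by (subst mult_elog_le_iff) (auto simp: sup_norm_le_iff sup_factor_def)
  qed
  then have "limsup (\<lambda>n. ereal ((1 - p) ^ n) * elog (sup_norm ((vderiv ^^ n) f)))
      \<le> limsup (\<lambda>n. ereal (?b n))"
    by (intro Limsup_mono) auto
  also have "?b \<longlonglongrightarrow> 0 + (\<theta> + total_weight - total_weight)"
    by (intro tendsto_intros q_power_tendsto_0 partial_weight_tendsto)
  then have "limsup (\<lambda>n. ereal (?b n)) = ereal \<theta>"
    by (intro lim_imp_Limsup) auto
  finally show ?thesis
    using assms by (auto simp: test_class_def intro: order_le_less_trans)
qed

section \<open>Closure of the test class under differences and limits\<close>

lemma test_class_smooth: "f \<in> test_class p \<theta> M \<Longrightarrow> smooth f"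
  by (simp add: test_class_def)

lemma test_classE:
  assumes "f \<in> test_class p \<theta> M"
  obtains K where "0 < K" "carleman_norm p M f \<le> ennreal K"
  using assms carleman_norm_finiteE[of p M f] unfolding test_class_def by blast

lemma test_class_diff:
  assumes f: "f \<in> test_class p \<theta> M" and g: "g \<in> test_class p \<theta> M"
  shows "(\<lambda>x. f x - g x) \<in> test_class p \<theta> M"
proof -
  obtain K1 K2 where K1: "0 < K1" "carleman_norm p M f \<le> ennreal K1"
    and K2: "0 < K2" "carleman_norm p M g \<le> ennreal K2"
    using f g by (metis test_classE)
  define L where "L = K1 + K2"
  have L: "0 < L" "carleman_norm p M f \<le> ennreal L" "carleman_norm p M g \<le> ennreal L"
    using K1 K2 by (auto simp: L_def intro: order_trans ennreal_leI)
  \<comment> \<open>One constant serves two purposes: the quasi-triangle inequality yields this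
    value for the norm, and the pointwise bounds need only \<open>2 * L\<close>, which is at most
    \<open>K\<close>.\<close>
  define K where "K = 2 powr (1 + 1 / p) * L"
  have "2 powr 1 \<le> 2 powr (1 + 1 / p)"
    using p_pos by (intro powr_mono) auto
  then have "2 * L \<le> K"
    using L(1) by (simp add: K_def)
  have sm: "smooth f" "smooth g"
    using f g by (auto dest: test_class_smooth)
  show ?thesis
  proof (rule test_classI)
    show "smooth (\<lambda>x. f x - g x)"
      using sm by (rule smooth_diff)
    show "0 < K"
      using L(1) by (simp add: K_def)
    show "carleman_norm p M (\<lambda>x. f x - g x) \<le> ennreal K"
      unfolding K_def using p_pos M_pos sm L by (intro carleman_norm_diff_le) auto
    fix m x
    have "norm ((vderiv ^^ m) f x - (vderiv ^^ m) g x) \<le> L * sup_factor m + L * sup_factor m"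
      using L test_class_sup_bound[OF f] test_class_sup_bound[OF g]
      by (intro order_trans[OF norm_triangle_ineq4] add_mono) auto
    also have "\<dots> \<le> K * sup_factor m"
      using mult_right_mono[OF \<open>2 * L \<le> K\<close>, of "sup_factor m"] by (simp add: sup_factor_def)
    finally show "norm ((vderiv ^^ m) (\<lambda>x. f x - g x) x) \<le> K * sup_factor m"
      using sm by (simp add: vderiv_iterate_diff)
  qed
qed

text \<open>Differences of members are again members, so \<open>test_class_sup_bound\<close> makes a
  Cauchy sequence uniformly Cauchy in every derivative. The uniform limits form a tower of
  derivatives of the limit function.\<close>

lemma test_class_complete:
  assumes f: "f \<in> cauchy_seqs p \<theta> M"
  obtains g where "g \<in> test_class p \<theta> M" "(\<lambda>k. carleman_norm p M (\<lambda>x. f k x - g x)) \<longlonglongrightarrow> 0"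
proof -
  let ?D = "\<lambda>n k. (vderiv ^^ n) (f k)"
  have ft: "f k \<in> test_class p \<theta> M" for k
    using f by (simp add: cauchy_seqs_def)
  then have sm: "smooth (f k)" for k
    by (rule test_class_smooth)
  have "\<exists>N. \<forall>k\<ge>N. \<forall>l\<ge>N. carleman_norm p M (\<lambda>x. f k x - f l x) \<le> ennreal e" if "0 < e" for e
    using f that unfolding cauchy_seqs_def by (blast intro: less_imp_le)
  then obtain N where N: "\<And>e k l. 0 < e \<Longrightarrow> N e \<le> k \<Longrightarrow> N e \<le> l \<Longrightarrow>
      carleman_norm p M (\<lambda>x. f k x - f l x) \<le> ennreal e"
    by metis
  have unif: "norm (?D n k x - ?D n l x) \<le> e * sup_factor n"
    if "0 < e" "N e \<le> k" "N e \<le> l" for n e k l x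
    using test_class_sup_bound[OF test_class_diff[OF ft ft] that(1) N[OF that]] sm
    by (simp add: vderiv_iterate_diff)
  have pos: "0 < sup_factor n" for n
    by (simp add: sup_factor_def)
  have "Cauchy (\<lambda>k. ?D n k x)" for n x
  proof (rule metric_CauchyI)
    fix e :: real
    assume "0 < e"
    define e' where "e' = e / (2 * sup_factor n)"
    have "0 < e'" "e' * sup_factor n < e"
      using \<open>0 < e\<close> pos[of n] by (auto simp: e'_def)
    then show "\<exists>N. \<forall>k\<ge>N. \<forall>l\<ge>N. dist (?D n k x) (?D n l x) < e"
      using unif[OF \<open>0 < e'\<close>] unfolding dist_norm by (blast intro: order_le_less_trans)
  qed
  then have "\<exists>l. (\<lambda>k. ?D n k x) \<longlonglongrightarrow> l" for n x
    using Cauchy_convergent convergent_def by blast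
  then obtain G where G: "\<And>n x. (\<lambda>k. ?D n k x) \<longlonglongrightarrow> G n x"
    by metis
  have G_unif: "norm (?D n k x - G n x) \<le> e * sup_factor n" if "0 < e" "N e \<le> k" for n e k x
  proof (rule tendsto_upperbound)
    show "(\<lambda>l. norm (?D n k x - ?D n l x)) \<longlonglongrightarrow> norm (?D n k x - G n x)"
      by (intro tendsto_intros G)
    show "\<forall>\<^sub>F l in sequentially. norm (?D n k x - ?D n l x) \<le> e * sup_factor n"
      using unif[OF that] unfolding eventually_sequentially by blast
  qed auto
  have der: "(G n has_vector_derivative G (Suc n) x) (at x)" for n x
  proof (rule has_vector_derivative_uniform_limit[OF smooth_has_vector_derivative[OF sm] G])
    fix e :: real
    assume "0 < e"
    then have "\<forall>x. norm (?D (Suc n) k x - G (Suc n) x) \<le> e" if "N (e / sup_factor (Suc n)) \<le> k" for k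
      using G_unif[OF _ that, of "Suc n"] pos[of "Suc n"] by simp
    then show "\<forall>\<^sub>F k in sequentially. \<forall>x. norm (?D (Suc n) k x - G (Suc n) x) \<le> e"
      unfolding eventually_sequentially by blast
  qed
  define g where "g = G 0"
  have sg: "smooth g" and DG: "\<And>n. (vderiv ^^ n) g = G n"
    unfolding g_def using smoothI[of G, OF der] vderiv_iterate_eqI[of G, OF der] by auto
  \<comment> \<open>With \<open>k\<close> fixed, \<open>l\<close> tends to infinity in the Cauchy
    estimate; Fatou's lemma carries the bound over to the limit.\<close>
  have conv: "carleman_norm p M (\<lambda>x. f k x - g x) \<le> ennreal e" if "0 < e" "N e \<le> k" for e k
  proof -
    have "Lp_norm p (\<lambda>x. ?D n k x - G n x) \<le> ennreal (e * M n)" for n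
    proof (rule Lp_norm_le_of_tendsto)
      show "(\<lambda>l. ?D n k x - ?D n l x) \<longlonglongrightarrow> ?D n k x - G n x" for x
        by (intro tendsto_intros G)
      show "(\<lambda>x. ?D n k x - ?D n l x) \<in> borel_measurable lborel" for l
        using smooth_measurable[OF sm] by (intro borel_measurable_diff) auto
      have "Lp_norm p (\<lambda>x. ?D n k x - ?D n l x) \<le> ennreal (e * M n)" if "N e \<le> l" for l
        using N[OF \<open>0 < e\<close> \<open>N e \<le> k\<close> that] \<open>0 < e\<close> M_pos sm
        by (simp add: carleman_norm_le_iff vderiv_iterate_diff)
      then show "\<forall>\<^sub>F l in sequentially. Lp_norm p (\<lambda>x. ?D n k x - ?D n l x) \<le> ennreal (e * M n)"
        unfolding eventually_sequentially by blast
    qed (use p_pos \<open>0 < e\<close> M_pos[of n] in auto)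
    then show ?thesis
      using sm sg M_pos that(1) by (simp add: carleman_norm_le_iff vderiv_iterate_diff DG)
  qed
  \<comment> \<open>Both bounds required by \<open>test_classI\<close> are at hand, with constant 1,
    for this difference; subtracting it from \<open>f (N 1)\<close> then gives
    \<open>g\<close>.\<close>
  have "(\<lambda>x. f (N 1) x - g x) \<in> test_class p \<theta> M"
  proof (rule test_classI)
    show "norm ((vderiv ^^ m) (\<lambda>x. f (N 1) x - g x) x) \<le> 1 * sup_factor m" for m x
      using G_unif[of 1 "N 1"] sm sg by (simp add: vderiv_iterate_diff DG)
  qed (use conv[of 1 "N 1"] sm sg in \<open>auto intro: smooth_diff\<close>)
  from test_class_diff[OF ft[of "N 1"] this] have "g \<in> test_class p \<theta> M"
    by simp
  moreover have "(\<lambda>k. carleman_norm p M (\<lambda>x. f k x - g x)) \<longlonglongrightarrow> 0"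
  proof (rule tendsto_zero_ennreal)
    fix r :: real
    assume "0 < r"
    then have "carleman_norm p M (\<lambda>x. f k x - g x) < ennreal r" if "N (r / 2) \<le> k" for k
      using conv[OF _ that] by (auto intro: order_le_less_trans simp: ennreal_lessI)
    then show "\<forall>\<^sub>F k in sequentially. carleman_norm p M (\<lambda>x. f k x - g x) < ennreal r"
      unfolding eventually_sequentially by blast
  qed
  ultimately show ?thesis
    by (rule that)
qed

end

subsection \<open>Equivalence classes\<close>

lemma Lp_norm_zero [simp]: "Lp_norm p (\<lambda>x. 0) = 0"
  by (simp add: Lp_norm_def ennreal_power_def)

lemma equiv_ae_equiv: "equiv (Lp_fun p) (ae_equiv p)"
proof (rule equivI)
  show "sym (ae_equiv p)"
    by (auto simp: sym_def ae_equiv_def elim: eventually_mono)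
  show "trans (ae_equiv p)"
    by (rule transI) (auto simp: ae_equiv_def elim: eventually_elim2)
qed (auto simp: refl_on_def ae_equiv_def)

lemma mem_Lp_class_iff:
  "f \<in> Lp_class p g \<longleftrightarrow> g \<in> Lp_fun p \<and> f \<in> Lp_fun p \<and> (AE x in lborel. g x = f x)"
  by (auto simp: Lp_class_def ae_equiv_def)

lemma Lp_class_eqI:
  assumes "f \<in> Lp_fun p" "g \<in> Lp_fun p" "AE x in lborel. f x = g x"
  shows "Lp_class p f = Lp_class p g"
  unfolding Lp_class_def
  by (rule equiv_class_eq[OF equiv_ae_equiv]) (use assms in \<open>auto simp: ae_equiv_def\<close>)

lemma rep_Lp_class:
  assumes "f \<in> Lp_fun p"
  shows "rep (Lp_class p f) \<in> Lp_fun p" "AE x in lborel. rep (Lp_class p f) x = f x"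
proof -
  have "f \<in> Lp_class p f"
    using assms by (simp add: mem_Lp_class_iff)
  then have "rep (Lp_class p f) \<in> Lp_class p f"
    unfolding rep_def by (rule someI[where P = "\<lambda>g. g \<in> Lp_class p f"])
  then show "rep (Lp_class p f) \<in> Lp_fun p" "AE x in lborel. rep (Lp_class p f) x = f x"
    by (auto simp: mem_Lp_class_iff elim: eventually_mono)
qed

lemma Lp_space_rep:
  assumes "A \<in> Lp_space p"
  shows "rep A \<in> Lp_fun p" "Lp_class p (rep A) = A"
proof -
  obtain f where f: "f \<in> Lp_fun p" and A: "A = Lp_class p f"
    using assms by (auto simp: Lp_space_def Lp_class_def elim: quotientE)
  show "rep A \<in> Lp_fun p" "Lp_class p (rep A) = A"
    using rep_Lp_class[OF f] Lp_class_eqI[OF _ f] by (simp_all add: A)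
qed

section \<open>The completion and its projections\<close>

context carleman_weight
begin

lemma equiv_null_equiv: "equiv (cauchy_seqs p \<theta> M) (null_equiv p \<theta> M)"
proof (rule equivI)
  have sm: "smooth (f k)" if "f \<in> cauchy_seqs p \<theta> M" for f k
    using that by (auto simp: cauchy_seqs_def test_class_def)
  show "refl_on (cauchy_seqs p \<theta> M) (null_equiv p \<theta> M)"
  proof (rule refl_onI)
    fix f
    assume f: "f \<in> cauchy_seqs p \<theta> M"
    have "carleman_norm p M (\<lambda>x. f k x - f k x) = 0" for k
      unfolding carleman_norm_def vderiv_iterate_diff[OF sm[OF f] sm[OF f]]
      by (simp add: seq_norm_def)
    with f show "(f, f) \<in> null_equiv p \<theta> M"
      by (simp add: null_equiv_def)
  qed
  show "sym (null_equiv p \<theta> M)"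
  proof (rule symI)
    fix f g
    assume fg: "(f, g) \<in> null_equiv p \<theta> M"
    then have "carleman_norm p M (\<lambda>x. f k x - g k x) = carleman_norm p M (\<lambda>x. g k x - f k x)" for k
      by (intro carleman_norm_minus_commute sm) (auto simp: null_equiv_def)
    with fg show "(g, f) \<in> null_equiv p \<theta> M"
      by (simp add: null_equiv_def)
  qed
  show "trans (null_equiv p \<theta> M)"
  proof (rule transI)
    fix f g h
    assume fg: "(f, g) \<in> null_equiv p \<theta> M" and gh: "(g, h) \<in> null_equiv p \<theta> M"
    then have c: "f \<in> cauchy_seqs p \<theta> M" "g \<in> cauchy_seqs p \<theta> M" "h \<in> cauchy_seqs p \<theta> M"
      by (auto simp: null_equiv_def)
    have "(\<lambda>k. carleman_norm p M (\<lambda>x. f k x - h k x)) \<longlonglongrightarrow> 0"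
    proof (rule tendsto_zero_ennreal)
      fix r :: real
      assume "0 < r"
      \<comment> \<open>Divides out the quasi-triangle constant; the extra factor 2 makes the
        resulting inequality strict.\<close>
      define e where "e = r / (2 * 2 powr (1 + 1 / p))"
      have e: "0 < e" "2 powr (1 + 1 / p) * e < r"
        using \<open>0 < r\<close> by (auto simp: e_def)
      have comm: "carleman_norm p M (\<lambda>x. h k x - g k x) = carleman_norm p M (\<lambda>x. g k x - h k x)" for k
        using c by (intro carleman_norm_minus_commute sm)
      have "\<forall>\<^sub>F k in sequentially. carleman_norm p M (\<lambda>x. f k x - g k x) < ennreal e"
        using fg e by (intro order_tendstoD(2)) (auto simp: null_equiv_def)
      moreover have "\<forall>\<^sub>F k in sequentially. carleman_norm p M (\<lambda>x. h k x - g k x) < ennreal e"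
        using gh e unfolding comm by (intro order_tendstoD(2)) (auto simp: null_equiv_def)
      ultimately show "\<forall>\<^sub>F k in sequentially. carleman_norm p M (\<lambda>x. f k x - h k x) < ennreal r"
      proof eventually_elim
        case (elim k)
        have "carleman_norm p M (\<lambda>x. (f k x - g k x) - (h k x - g k x))
            \<le> ennreal (2 powr (1 + 1 / p) * e)"
          using p_pos M_pos e elim c
          by (intro carleman_norm_diff_le) (auto intro: smooth_diff sm less_imp_le)
        also have "\<dots> < ennreal r"
          using e \<open>0 < r\<close> by (intro ennreal_lessI) auto
        finally show ?case
          by simp
      qed
    qed
    with c show "(f, h) \<in> null_equiv p \<theta> M"
      by (simp add: null_equiv_def)
  qed
qed (auto simp: null_equiv_def)

lemma const_cauchy:
  assumes "g \<in> test_class p \<theta> M"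
  shows "(\<lambda>k. g) \<in> cauchy_seqs p \<theta> M"
proof -
  have "carleman_norm p M (\<lambda>x. g x - g x) = 0"
    unfolding carleman_norm_def vderiv_iterate_diff[OF test_class_smooth test_class_smooth, OF assms assms]
    by (simp add: seq_norm_def)
  then show ?thesis
    using assms by (auto simp: cauchy_seqs_def)
qed

text \<open>A Cauchy sequence is equivalent to the constant sequence at its limit in the test class,
  so its class is the image of that limit.\<close>

lemma canonical_embedding_image:
  "canonical_embedding p \<theta> M ` test_class p \<theta> M = carleman_space p \<theta> M"
proof
  show "canonical_embedding p \<theta> M ` test_class p \<theta> M \<subseteq> carleman_space p \<theta> M"
    by (auto simp: canonical_embedding_def carleman_space_def intro: quotientI const_cauchy)
  show "carleman_space p \<theta> M \<subseteq> canonical_embedding p \<theta> M ` test_class p \<theta> M"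
  proof
    fix w
    assume "w \<in> carleman_space p \<theta> M"
    then obtain f where f: "f \<in> cauchy_seqs p \<theta> M" and w: "w = null_equiv p \<theta> M `` {f}"
      unfolding carleman_space_def by (rule quotientE)
    obtain g where g: "g \<in> test_class p \<theta> M"
      and lim: "(\<lambda>k. carleman_norm p M (\<lambda>x. f k x - g x)) \<longlonglongrightarrow> 0"
      using f by (rule test_class_complete)
    have "(f, \<lambda>k. g) \<in> null_equiv p \<theta> M"
      using f const_cauchy[OF g] lim by (simp add: null_equiv_def)
    then have "w = canonical_embedding p \<theta> M g"
      unfolding w canonical_embedding_def by (rule equiv_class_eq[OF equiv_null_equiv])
    with g show "w \<in> canonical_embedding p \<theta> M ` test_class p \<theta> M"
      by blast
  qed
qed

lemma test_class_Lp_fun: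
  assumes "f \<in> test_class p \<theta> M"
  shows "(vderiv ^^ n) f \<in> Lp_fun p"
proof -
  obtain K where "0 < K" "carleman_norm p M f \<le> ennreal K"
    using assms by (rule test_classE)
  then have "Lp_norm p ((vderiv ^^ n) f) \<le> ennreal (K * M n)"
    using M_pos by (simp add: carleman_norm_le_iff)
  then show ?thesis
    using smooth_measurable[OF test_class_smooth[OF assms], of n]
    by (auto simp: Lp_fun_def intro: order_le_less_trans)
qed

text \<open>Evaluates the definite description in \<open>proj\<close>. Representatives agree almost
  everywhere with the derivatives, so \<open>linf_dist\<close> between images of test functions is
  the Carleman norm of their difference, and convergence in the completion carries over.\<close>

lemma proj_canonical_embedding:
  assumes g: "g \<in> test_class p \<theta> M"
  shows "proj p M (canonical_embedding p \<theta> M g) = proj_test p g"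
  unfolding proj_def
proof (rule the_equality)
  note ae = rep_Lp_class(2)[OF test_class_Lp_fun]
  have "Lp_norm p (rep (proj_test p g n)) = Lp_norm p ((vderiv ^^ n) g)" for n
    unfolding proj_test_def by (rule Lp_norm_cong_AE) (rule ae[OF g])
  then have "seq_norm p M (\<lambda>n. rep (proj_test p g n)) < \<infinity>"
    using g by (simp add: seq_norm_def test_class_def carleman_norm_def)
  moreover have "proj_test p g n \<in> Lp_space p" for n
    unfolding proj_test_def Lp_class_def Lp_space_def
    using test_class_Lp_fun[OF g] by (rule quotientI)
  ultimately have "proj_test p g \<in> linf_Lp p M"
    by (simp add: linf_Lp_def)
  moreover have "(\<lambda>k. linf_dist p M (proj_test p (f k)) (proj_test p g)) \<longlonglongrightarrow> 0"
    if f: "f \<in> canonical_embedding p \<theta> M g" for f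
  proof -
    have ft: "f k \<in> test_class p \<theta> M" for k
      using f by (auto simp: canonical_embedding_def null_equiv_def cauchy_seqs_def)
    \<comment> \<open>The order \<open>g x - f k x\<close> matches the pairs of
      \<open>null_equiv\<close>, in which the constant sequence comes first.\<close>
    have "Lp_norm p (\<lambda>x. rep (proj_test p (f k) n) x - rep (proj_test p g n) x)
        = Lp_norm p ((vderiv ^^ n) (\<lambda>x. g x - f k x))" for k n
    proof -
      have "Lp_norm p (\<lambda>x. rep (proj_test p (f k) n) x - rep (proj_test p g n) x)
          = Lp_norm p (\<lambda>x. (vderiv ^^ n) (f k) x - (vderiv ^^ n) g x)"
        unfolding proj_test_def
        by (rule Lp_norm_cong_AE) (use ae[OF g, of n] ae[OF ft, of n k] in \<open>eventually_elim, simp\<close>)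
      then show ?thesis
        by (simp add: vderiv_iterate_diff test_class_smooth[OF g] test_class_smooth[OF ft]
            Lp_norm_minus_commute[of p "(vderiv ^^ n) g"])
    qed
    then have "linf_dist p M (proj_test p (f k)) (proj_test p g) = carleman_norm p M (\<lambda>x. g x - f k x)" for k
      by (simp add: linf_dist_def carleman_norm_def seq_norm_def)
    then show ?thesis
      using f by (simp add: canonical_embedding_def null_equiv_def)
  qed
  ultimately show "proj_test p g \<in> linf_Lp p M \<and> (\<forall>f\<in>canonical_embedding p \<theta> M g.
      (\<lambda>k. linf_dist p M (proj_test p (f k)) (proj_test p g)) \<longlonglongrightarrow> 0)"
    by blast
  fix F
  assume F: "F \<in> linf_Lp p M \<and> (\<forall>f\<in>canonical_embedding p \<theta> M g.
      (\<lambda>k. linf_dist p M (proj_test p (f k)) F) \<longlonglongrightarrow> 0)"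
  \<comment> \<open>Uniqueness: along the constant sequence the distance to \<open>F\<close> does
    not vary, so its convergence to 0 forces it to be 0.\<close>
  have "(\<lambda>k. g) \<in> canonical_embedding p \<theta> M g"
    using equiv_class_self[OF equiv_null_equiv const_cauchy[OF g]]
    by (simp add: canonical_embedding_def)
  with F have "linf_dist p M (proj_test p g) F = 0"
    by (auto simp: LIMSEQ_const_iff)
  then have "seq_norm p M (\<lambda>n x. rep (proj_test p g n) x - rep (F n) x) \<le> ennreal 0"
    by (simp add: linf_dist_def)
  then have zero: "Lp_norm p (\<lambda>x. rep (proj_test p g n) x - rep (F n) x) = 0" for n
    using M_pos by (subst (asm) seq_norm_le_iff) auto
  show "F = proj_test p g"
  proof
    fix n
    have Fn: "F n \<in> Lp_space p"
      using F by (simp add: linf_Lp_def)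
    have "rep (F n) \<in> borel_measurable lborel" "rep (proj_test p g n) \<in> borel_measurable lborel"
      using Lp_space_rep(1)[OF Fn] rep_Lp_class(1)[OF test_class_Lp_fun[OF g]]
      by (auto simp: Lp_fun_def proj_test_def)
    then have "AE x in lborel. rep (proj_test p g n) x - rep (F n) x = 0"
      using zero p_pos by (intro Lp_norm_eq_0_AE) auto
    then have "AE x in lborel. rep (F n) x = (vderiv ^^ n) g x"
      using ae[OF g, of n] unfolding proj_test_def by eventually_elim simp
    then have "Lp_class p (rep (F n)) = Lp_class p ((vderiv ^^ n) g)"
      using Lp_space_rep(1)[OF Fn] test_class_Lp_fun[OF g] by (intro Lp_class_eqI)
    then show "F n = proj_test p g n"
      using Lp_space_rep(2)[OF Fn] by (simp add: proj_test_def)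
  qed
qed

text \<open>A class modulo null sets contains at most one continuous function. Membership in a
  projection thus becomes equality of functions.\<close>

lemma smooth_mem_proj_test_iff:
  assumes g: "g \<in> test_class p \<theta> M" and h: "smooth h"
  shows "h \<in> proj_test p g n \<longleftrightarrow> h = (vderiv ^^ n) g"
proof
  assume "h \<in> proj_test p g n"
  then have "AE x in lborel. h x = (vderiv ^^ n) g x"
    by (auto simp: proj_test_def mem_Lp_class_iff elim: eventually_mono)
  then show "h = (vderiv ^^ n) g"
    using smooth_continuous[OF h, of UNIV 0] smooth_continuous[OF test_class_smooth[OF g]]
    by (intro continuous_AE_eq_imp_eq) auto
qed (use test_class_Lp_fun[OF g] in \<open>simp add: proj_test_def mem_Lp_class_iff\<close>)

end

theorem theorem0p6p1:
  fixes p \<theta> :: real and M :: "nat \<Rightarrow> real"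
  assumes "0 < p" and "p < 1" and "0 \<le> \<theta>"
    and "\<And>n. 0 < M n"
    and "log_convex M"
    and "p_characteristic p M < \<infinity>"
  shows "(\<forall>n. \<forall>f \<in> carleman_space p \<theta> M. \<exists>g. smooth g \<and> g \<in> proj p M f n)
    \<and> (\<forall>n. \<forall>f \<in> carleman_space p \<theta> M. \<forall>g. smooth g \<and> g \<in> proj p M f n
          \<longrightarrow> vderiv g \<in> proj p M f (Suc n))
    \<and> inj_on (\<lambda>f. proj p M f 0) (carleman_space p \<theta> M)
    \<and> canonical_embedding p \<theta> M ` test_class p \<theta> M = carleman_space p \<theta> M"
proof -
  interpret carleman_weight p \<theta> M
    using assms by unfold_locales auto
  let ?W = "carleman_space p \<theta> M"
  \<comment> \<open>By completeness each element of the space comes from a test function, whose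
    derivatives represent its projections; every claim reduces to one about test functions.\<close>
  have cases: "\<exists>g\<in>test_class p \<theta> M. w = canonical_embedding p \<theta> M g \<and> proj p M w = proj_test p g"
    if "w \<in> ?W" for w
    using that canonical_embedding_image proj_canonical_embedding by (metis imageE)
  note iterate = smooth_iterate[OF test_class_smooth]
  have "\<exists>h. smooth h \<and> h \<in> proj p M w n" if w: "w \<in> ?W" for w n
    using cases[OF w] iterate smooth_mem_proj_test_iff by metis
  moreover have "vderiv h \<in> proj p M w (Suc n)" if w: "w \<in> ?W" and h: "smooth h" "h \<in> proj p M w n" for w n h
  proof -
    obtain g where g: "g \<in> test_class p \<theta> M" and w: "proj p M w = proj_test p g"
      using cases[OF w] by blast
    have "h = (vderiv ^^ n) g"
      using h smooth_mem_proj_test_iff[OF g] by (simp add: w)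
    then show ?thesis
      using smooth_mem_proj_test_iff[OF g iterate[OF g], of "Suc n" "Suc n"] by (simp add: w)
  qed
  moreover have "inj_on (\<lambda>w. proj p M w 0) ?W"
  proof (rule inj_onI)
    fix v w
    assume "v \<in> ?W" "w \<in> ?W" and eq: "proj p M v 0 = proj p M w 0"
    then obtain f g where f: "f \<in> test_class p \<theta> M" "v = canonical_embedding p \<theta> M f" "proj p M v = proj_test p f"
      and g: "g \<in> test_class p \<theta> M" "w = canonical_embedding p \<theta> M g" "proj p M w = proj_test p g"
      using cases by meson
    \<comment> \<open>\<open>f\<close> lies in its own zeroth projection, hence in that of
      \<open>g\<close>, whose only smooth member is \<open>g\<close>.\<close>
    have "f \<in> proj_test p g 0"
      using smooth_mem_proj_test_iff[OF f(1) test_class_smooth[OF f(1)], of 0] eq f(3) g(3) by simp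
    then have "f = g"
      using smooth_mem_proj_test_iff[OF g(1) test_class_smooth[OF f(1)], of 0] by simp
    then show "v = w"
      using f(2) g(2) by simp
  qed
  ultimately show ?thesis
    using canonical_embedding_image by blast
qed

end
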